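(* In the general network game with endogenous links described in the context, let $(\boldsymbol{\beta}^*,\boldsymbol{\sigma}^* )$ be an optimal subsidy such that (1) the equilibrium selection $(\boldsymbol{\beta},\boldsymbol{\sigma})\mapsto(\boldsymbol{a}^*(\boldsymbol{\beta},\boldsymbol{\sigma}),\boldsymbol{g}^*(\boldsymbol{\beta},\boldsymbol{\sigma}))$ is differentiable in a neighborhood of $(\boldsymbol{\beta}^*,\boldsymbol{\sigma}^* )$, and (2) the planner's budget constraint strictly binds at $(\boldsymbol{\beta}^*,\boldsymbol{\sigma}^* )$. Let $i\ne j$ be agents with $s_{ij}\ge0$. If (a) the link formation cost function $F_{ij}=F_{ji}$ is super-quadratic, and (b) the payoff functions $u_{ij}$ and $u_{ji}$ are sub-linear, then $\sigma_{ij}^*=\sigma_{ji}^*=0$.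
   Context: **Game.** There are $n$ agents $\mathcal{N}=\{1,\dots,n\}$. Simultaneously, each agent $i$ chooses an action $a_i\ge 0$ and link intensities $g_{ij}\ge 0$ for all $j\in\mathcal{N}\setminus\{i\}$. Link strengths are $G_{ij}=G_{ji}=g_{ij}+g_{ji}$ for $i\neq j$. Agent $i$'s utility without subsidies is $$U_i(\boldsymbol a,\boldsymbol g)=b_ia_i+\rho\sum_{j\ne i}G_{ij}u_{ij}(a_i)u_{ji}(a_j)-C_i(a_i)+\sum_{j\ne i}s_{ij}G_{ij}-\sum_{j\ne i}F_{ij}(g_{ij}),$$ where $b_i>0$; $\rho>0$; $s_{ij}=s_{ji}\in\mathbb R$; $C_i:\mathbb R_{\ge0}\to\mathbb R_{\ge0}$ is twice differentiable, strictly increasing and strictly convex with $C_i'(0)=0$; $F_{ij}=F_{ji}:\mathbb R_{\ge0}\to\mathbb R_{\ge0}$ is twice differentiable, strictly increasing and strictly convex with $F_{ij}'(0)=0$; $u_{ij}:\mathbb R_{\ge0}\to\mathbb R_{\ge0}$ is twice differentiable and strictly increasing with $u_{ij}(0)=0$. **Function classes.** $F$ is *super-quadratic* if $GF''(G)\ge F'(G)$ for all $G\ge0$ and $F'$ is convex. $u$ is *sub-linear* if $u(a)\ge a\,u'(a)$ for all $a\ge0$. **Subsidies.** A subsidy is $(\boldsymbol{\beta},\boldsymbol{\sigma})$ with $\beta_i\ge0$ and $\sigma_{ij}\ge0$ for ordered pairs $i\ne j$ (not necessarily symmetric). Under it agent $i$'s utility is $\mathcal{U}_i=U_i(\boldsymbol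 a,\boldsymbol g)+\beta_ia_i+\sum_{j\ne i}\sigma_{ij}G_{ij}$, and the planner pays $\mathcal{P}=\sum_i\beta_ia_i+\sum_i\sum_{j\ne i}\sigma_{ij}G_{ij}$. Agents play a pure strategy Nash equilibrium of the game with utilities $\mathcal U_i$. An equilibrium selection $(\boldsymbol{a}^*(\boldsymbol{\beta},\boldsymbol{\sigma}),\boldsymbol{g}^*(\boldsymbol{\beta},\boldsymbol{\sigma}))$ is fixed (it assigns a pure Nash equilibrium to each subsidy for which one exists; welfare is set to $-\infty$ where none exists). **Planner.** The objective $\mathcal{W}(\boldsymbol a)$ is differentiable and strictly increasing in each argument; the budget is $\mathcal{B}>0$. A subsidy is optimal if an equilibrium exists under it, $\mathcal{P}\le\mathcal{B}$ at the selected equilibrium, and it maximizes $\mathcal{W}(\boldsymbol{a}^*(\boldsymbol{\beta},\boldsymbol{\sigma}))$ among subsidies satisfying the budget constraint at the selected equilibrium. **Conventions.** Neighborhoods and derivatives in $(\boldsymbol\beta,\boldsymbol\sigma)$ are relative to the set of nonnegative subsidies (one-sided at the boundary). The budget constraint *strictly binds* at $(\boldsymbol{\beta}^*,\boldsymbol{\sigma}^* )$ if $\mathcal P=\mathcal B$ there and the Karush–Kuhn–Tucker first-order conditions hold there with a strictly positive multiplier: there is $\lambda>0$ such that, viewing $\mathcal{L}=\mathcal{W}-\lambda\mathcal{P}$ (evaluated at the selected equilibrium) as a function of $(\boldsymbol\beta,\boldsymbol\sigma)$, at $(\boldsymbol{\beta}^*,\boldsymbol{\sigma}^* )$ one has $\frac{d\mathcal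 L}{d\beta_k}\le0$ with equality if $\beta_k^*>0$, and $\frac{d\mathcal L}{d\sigma_{kl}}\le0$ with equality if $\sigma_{kl}^*>0$, for all $k$ and all $k\neq l$. *)

theory Defs
  imports "HOL-Analysis.Analysis"
begin

text \<open>
  All primitive functions live on \<open>[0, \<infinity>)\<close> and are represented by total functions on the reals
  whose values at negative arguments are irrelevant.  Derivatives are therefore taken relative to
  \<open>[0, \<infinity>)\<close>; in particular they are one-sided at \<open>0\<close>.
\<close>

definition deriv_nn :: "(real \<Rightarrow> real) \<Rightarrow> real \<Rightarrow> real" where
  "deriv_nn f x = vector_derivative f (at x within {0..})"

definition twice_differentiable_nn :: "(real \<Rightarrow> real) \<Rightarrow> bool" where
  "twice_differentiable_nn f \<longleftrightarrow>
     f differentiable_on {0..} \<and> deriv_nn f differentiable_on {0..}"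

definition strictly_convex_on :: "real set \<Rightarrow> (real \<Rightarrow> real) \<Rightarrow> bool" where
  "strictly_convex_on S f \<longleftrightarrow> convex S \<and>
     (\<forall>x\<in>S. \<forall>y\<in>S. \<forall>t. x \<noteq> y \<and> 0 < t \<and> t < 1 \<longrightarrow>
        f ((1 - t) * x + t * y) < (1 - t) * f x + t * f y)"

definition cost_function :: "(real \<Rightarrow> real) \<Rightarrow> bool" where
  "cost_function f \<longleftrightarrow>
     (\<forall>x\<ge>0. 0 \<le> f x) \<and> twice_differentiable_nn f \<and>
     strict_mono_on {0..} f \<and> strictly_convex_on {0..} f \<and> deriv_nn f 0 = 0"

definition payoff_function :: "(real \<Rightarrow> real) \<Rightarrow> bool" where
  "payoff_function f \<longleftrightarrow>
     (\<forall>x\<ge>0. 0 \<le> f x) \<and> twice_differentiable_nn f \<and>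
     strict_mono_on {0..} f \<and> f 0 = 0"

definition super_quadratic :: "(real \<Rightarrow> real) \<Rightarrow> bool" where
  "super_quadratic f \<longleftrightarrow>
     (\<forall>x\<ge>0. x * deriv_nn (deriv_nn f) x \<ge> deriv_nn f x) \<and> convex_on {0..} (deriv_nn f)"

definition sub_linear :: "(real \<Rightarrow> real) \<Rightarrow> bool" where
  "sub_linear f \<longleftrightarrow> (\<forall>x\<ge>0. f x \<ge> x * deriv_nn f x)"

text \<open>
  The set of agents is the finite type \<open>'n\<close>.  In the usual notation the fields are
  \<open>b\<^sub>i\<close>, \<open>\<rho>\<close>, \<open>s\<^sub>i\<^sub>j\<close>, \<open>C\<^sub>i\<close>, \<open>F\<^sub>i\<^sub>j\<close>, \<open>u\<^sub>i\<^sub>j\<close>; those indexed by two agents are only meaningful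
  off the diagonal.
\<close>

record 'n network_game =
  ben :: "'n \<Rightarrow> real"
  rho :: real
  lsv :: "'n \<Rightarrow> 'n \<Rightarrow> real"
  acost :: "'n \<Rightarrow> real \<Rightarrow> real"
  lcost :: "'n \<Rightarrow> 'n \<Rightarrow> real \<Rightarrow> real"
  pay :: "'n \<Rightarrow> 'n \<Rightarrow> real \<Rightarrow> real"

definition valid_game :: "'n network_game \<Rightarrow> bool" where
  "valid_game \<Gamma> \<longleftrightarrow>
     (\<forall>i. ben \<Gamma> i > 0) \<and> rho \<Gamma> > 0 \<and>
     (\<forall>i. cost_function (acost \<Gamma> i)) \<and>
     (\<forall>i j. i \<noteq> j \<longrightarrow>
        lsv \<Gamma> i j = lsv \<Gamma> j i \<and>
        cost_function (lcost \<Gamma> i j) \<and> (\<forall>x\<ge>0. lcost \<Gamma> i j x = lcost \<Gamma> j i x) \<and>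
        payoff_function (pay \<Gamma> i j))"

text \<open>
  A profile is a pair \<open>(a, g)\<close> and a subsidy a pair \<open>(\<beta>, \<sigma>)\<close>, each consisting of a vector indexed
  by agents and a matrix indexed by ordered pairs of distinct agents.  The latter is represented by
  a square matrix with zero diagonal.  Hence profiles and subsidies range over the same set.
\<close>

type_synonym 'n vecmat = "(real ^ 'n) \<times> (real ^ 'n ^ 'n)"

definition nonneg_vecmats :: "('n::finite) vecmat set" where
  "nonneg_vecmats =
     {(v, M). (\<forall>i. 0 \<le> v $ i) \<and> (\<forall>i j. 0 \<le> M $ i $ j) \<and> (\<forall>i. M $ i $ i = 0)}"

definition vec_upd :: "'a ^ 'n \<Rightarrow> 'n::finite \<Rightarrow> 'a \<Rightarrow> 'a ^ 'n" where
  "vec_upd v i x = (\<chi> k. if k = i then x else v $ k)"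

definition mat_upd :: "'a ^ 'n ^ 'n \<Rightarrow> 'n::finite \<Rightarrow> 'n \<Rightarrow> 'a \<Rightarrow> 'a ^ 'n ^ 'n" where
  "mat_upd M i j x = vec_upd M i (vec_upd (M $ i) j x)"

definition link :: "real ^ 'n ^ 'n \<Rightarrow> 'n::finite \<Rightarrow> 'n \<Rightarrow> real" where
  "link g i j = g $ i $ j + g $ j $ i"

definition base_utility :: "('n::finite) network_game \<Rightarrow> 'n \<Rightarrow> 'n vecmat \<Rightarrow> real" where
  "base_utility \<Gamma> i = (\<lambda>(a, g).
     ben \<Gamma> i * a $ i
     + rho \<Gamma> * (\<Sum>j\<in>UNIV - {i}. link g i j * pay \<Gamma> i j (a $ i) * pay \<Gamma> j i (a $ j))
     - acost \<Gamma> i (a $ i)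
     + (\<Sum>j\<in>UNIV - {i}. lsv \<Gamma> i j * link g i j)
     - (\<Sum>j\<in>UNIV - {i}. lcost \<Gamma> i j (g $ i $ j)))"

definition transfer :: "('n::finite) vecmat \<Rightarrow> 'n \<Rightarrow> 'n vecmat \<Rightarrow> real" where
  "transfer = (\<lambda>(\<beta>, \<sigma>) i (a, g).
     \<beta> $ i * a $ i + (\<Sum>j\<in>UNIV - {i}. \<sigma> $ i $ j * link g i j))"

definition utility ::
    "('n::finite) network_game \<Rightarrow> 'n vecmat \<Rightarrow> 'n \<Rightarrow> 'n vecmat \<Rightarrow> real" where
  "utility \<Gamma> s i p = base_utility \<Gamma> i p + transfer s i p"

definition payment :: "('n::finite) vecmat \<Rightarrow> 'n vecmat \<Rightarrow> real" where
  "payment s p = (\<Sum>i\<in>UNIV. transfer s i p)"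

definition deviation :: "('n::finite) vecmat \<Rightarrow> 'n \<Rightarrow> real \<Rightarrow> real ^ 'n \<Rightarrow> 'n vecmat" where
  "deviation p i x h = (vec_upd (fst p) i x, vec_upd (snd p) i h)"

definition nash :: "('n::finite) network_game \<Rightarrow> 'n vecmat \<Rightarrow> 'n vecmat \<Rightarrow> bool" where
  "nash \<Gamma> s p \<longleftrightarrow> p \<in> nonneg_vecmats \<and>
     (\<forall>i x h. deviation p i x h \<in> nonneg_vecmats \<longrightarrow>
        utility \<Gamma> s i (deviation p i x h) \<le> utility \<Gamma> s i p)"

definition has_nash :: "('n::finite) network_game \<Rightarrow> 'n vecmat \<Rightarrow> bool" where
  "has_nash \<Gamma> s \<longleftrightarrow> (\<exists>p. nash \<Gamma> s p)"

text \<open>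
  A selection is partial, with domain the nonnegative subsidies that admit an equilibrium; its
  values elsewhere are irrelevant.
\<close>

definition equilibrium_selection ::
    "('n::finite) network_game \<Rightarrow> ('n vecmat \<Rightarrow> 'n vecmat) \<Rightarrow> bool" where
  "equilibrium_selection \<Gamma> sel \<longleftrightarrow>
     (\<forall>s\<in>nonneg_vecmats. has_nash \<Gamma> s \<longrightarrow> nash \<Gamma> s (sel s))"

text \<open>
  Differentiability near a subsidy presupposes that the selection is defined near it.  Both the
  neighbourhood and the derivatives are relative to the set of nonnegative subsidies.
\<close>

definition selection_differentiable_near ::
    "('n::finite) network_game \<Rightarrow> ('n vecmat \<Rightarrow> 'n vecmat) \<Rightarrow> 'n vecmat \<Rightarrow> bool" where
  "selection_differentiable_near \<Gamma> sel s \<longleftrightarrow>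
     (\<exists>U. open U \<and> s \<in> U \<and>
        (\<forall>t \<in> U \<inter> nonneg_vecmats.
           has_nash \<Gamma> t \<and> sel differentiable (at t within nonneg_vecmats)))"

definition planner_objective :: "(real ^ 'n::finite \<Rightarrow> real) \<Rightarrow> bool" where
  "planner_objective W \<longleftrightarrow>
     W differentiable_on {a. \<forall>k. 0 \<le> a $ k} \<and>
     (\<forall>a k x. (\<forall>l. 0 \<le> a $ l) \<and> a $ k < x \<longrightarrow> W a < W (vec_upd a k x))"

definition welfare ::
    "('n::finite) network_game \<Rightarrow> (real ^ 'n \<Rightarrow> real) \<Rightarrow> ('n vecmat \<Rightarrow> 'n vecmat) \<Rightarrow>
     'n vecmat \<Rightarrow> ereal" where
  "welfare \<Gamma> W sel s = (if has_nash \<Gamma> s then ereal (W (fst (sel s))) else -\<infinity>)"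

text \<open>
  Subsidies without an equilibrium need no separate treatment in the last conjunct below, since
  their welfare is \<open>-\<infinity>\<close>.
\<close>

definition optimal_subsidy ::
    "('n::finite) network_game \<Rightarrow> (real ^ 'n \<Rightarrow> real) \<Rightarrow> real \<Rightarrow>
     ('n vecmat \<Rightarrow> 'n vecmat) \<Rightarrow> 'n vecmat \<Rightarrow> bool" where
  "optimal_subsidy \<Gamma> W B sel s \<longleftrightarrow>
     s \<in> nonneg_vecmats \<and> has_nash \<Gamma> s \<and> payment s (sel s) \<le> B \<and>
     (\<forall>t\<in>nonneg_vecmats. payment t (sel t) \<le> B \<longrightarrow>
        welfare \<Gamma> W sel t \<le> welfare \<Gamma> W sel s)"

definition lagrangian ::
    "(real ^ 'n \<Rightarrow> real) \<Rightarrow> ('n vecmat \<Rightarrow> 'n vecmat) \<Rightarrow> real \<Rightarrow> ('n::finite) vecmat \<Rightarrow> real" where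
  "lagrangian W sel \<mu> s = W (fst (sel s)) - \<mu> * payment s (sel s)"

text \<open>
  First-order condition for maximising \<open>f\<close> over \<open>[0, \<infinity>)\<close> at \<open>x\<close>, complementary slackness included.
\<close>

definition foc_nn :: "(real \<Rightarrow> real) \<Rightarrow> real \<Rightarrow> bool" where
  "foc_nn f x \<longleftrightarrow>
     (\<exists>D. (f has_real_derivative D) (at x within {0..}) \<and> D \<le> 0 \<and> (x > 0 \<longrightarrow> D = 0))"

definition budget_strictly_binds ::
    "(real ^ 'n \<Rightarrow> real) \<Rightarrow> real \<Rightarrow> ('n vecmat \<Rightarrow> 'n vecmat) \<Rightarrow> ('n::finite) vecmat \<Rightarrow> bool" where
  "budget_strictly_binds W B sel = (\<lambda>(\<beta>, \<sigma>).
     payment (\<beta>, \<sigma>) (sel (\<beta>, \<sigma>)) = B \<and>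
     (\<exists>\<mu>>0.
        (\<forall>k. foc_nn (\<lambda>t. lagrangian W sel \<mu> (vec_upd \<beta> k t, \<sigma>)) (\<beta> $ k)) \<and>
        (\<forall>k l. k \<noteq> l \<longrightarrow>
           foc_nn (\<lambda>t. lagrangian W sel \<mu> (\<beta>, mat_upd \<sigma> k l t)) (\<sigma> $ k $ l))))"

end

theory Submission
  imports Defs
begin

text \<open>
  Suppose \<open>\<sigma>\<^sub>i\<^sub>j \<ge> \<sigma>\<^sub>j\<^sub>i\<close> and \<open>\<sigma>\<^sub>i\<^sub>j > 0\<close>.  Lower \<open>\<sigma>\<^sub>i\<^sub>j\<close> slightly and raise \<open>\<beta>\<^sub>i\<close> and \<open>\<beta>\<^sub>j\<close> so that the lost
  marginal returns to actions are compensated: then only \<open>g\<^sub>i\<^sub>j\<close> changes and welfare stays constant.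
  Per unit of \<open>g\<^sub>i\<^sub>j\<close> the planner saves \<open>F''(g\<^sub>i\<^sub>j) G\<^sub>i\<^sub>j + \<sigma>\<^sub>i\<^sub>j + \<sigma>\<^sub>j\<^sub>i\<close> on links, and
  \<open>F''(g\<^sub>i\<^sub>j) G\<^sub>i\<^sub>j \<ge> F'(g\<^sub>i\<^sub>j) + F'(g\<^sub>j\<^sub>i) \<ge> 2\<rho>u\<^sub>i\<^sub>ju\<^sub>j\<^sub>i\<close> as \<open>F\<close> is super-quadratic, whereas the
  compensation costs \<open>\<rho>(a\<^sub>iu'\<^sub>i\<^sub>ju\<^sub>j\<^sub>i + a\<^sub>ju'\<^sub>j\<^sub>iu\<^sub>i\<^sub>j) \<le> 2\<rho>u\<^sub>i\<^sub>ju\<^sub>j\<^sub>i\<close> as the \<open>u\<close> are sub-linear.  So the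
  Lagrangian strictly increases, contradicting the first-order conditions.

  That the selected equilibrium really responds in this way follows from its differentiability: the
  first-order conditions of the agents express the subsidies as a function of the equilibrium, so
  the derivative of the selection is injective on the space of subsidies on active links.  It maps
  this space into the corresponding space of profiles, and hence onto it.
\<close>

section \<open>Derivatives on the half-line\<close>

lemma at_within_atLeast_neq_bot:
  fixes x :: real
  assumes "0 \<le> x"
  shows "at x within {0..} \<noteq> bot"
proof -
  have "at_right x \<le> at x within {0..}"
    using assms by (intro at_le) auto
  then show ?thesis
    using trivial_limit_at_right_real[of x] bot.extremum_unique by (metis trivial_limit_def)
qed

lemma deriv_nn_has_real_derivative:
  assumes "f differentiable_on {0..}" "0 \<le> x"
  shows "(f has_real_derivative deriv_nn f x) (at x within {0..})"
  using assms unfolding deriv_nn_def has_real_derivative_iff_has_vector_derivative differentiable_on_def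
  by (simp add: vector_derivative_works)

lemma deriv_nn_cong:
  assumes "\<And>y. 0 \<le> y \<Longrightarrow> f y = g y" "0 \<le> x"
  shows "deriv_nn f x = deriv_nn g x"
proof -
  have "(f has_vector_derivative d) (at x within {0..}) \<longleftrightarrow>
        (g has_vector_derivative d) (at x within {0..})" for d
    using assms
      has_vector_derivative_transform[of x "{0..}" f g d] has_vector_derivative_transform[of x "{0..}" g f d]
    by auto
  then show ?thesis
    by (simp add: deriv_nn_def vector_derivative_def)
qed

text \<open>Used to pass from \<open>lcost \<Gamma> i j\<close> to
  \<open>lcost \<Gamma> j i\<close>, which agree on the half-line only; derivatives relative to the
  half-line do not see values elsewhere.\<close>

lemma super_quadratic_cong:
  assumes "\<And>y. 0 \<le> y \<Longrightarrow> f y = g y" "super_quadratic f"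
  shows "super_quadratic g"
proof -
  have 1: "deriv_nn f y = deriv_nn g y" if "0 \<le> y" for y
    using assms(1) that by (rule deriv_nn_cong)
  have 2: "deriv_nn (deriv_nn f) y = deriv_nn (deriv_nn g) y" if "0 \<le> y" for y
    using 1 that by (rule deriv_nn_cong)
  show ?thesis
    using assms(2) unfolding super_quadratic_def
    by (auto simp: 1 2 convex_on_def)
qed

lemma deriv_within_atLeast_nonneg:
  fixes f :: "real \<Rightarrow> real"
  assumes "(f has_real_derivative D) (at x within {0..})" "0 \<le> x"
    and "\<forall>\<^sub>F y in at x within {0..}. 0 \<le> (f y - f x) / (y - x)"
  shows "0 \<le> D"
  using assms at_within_atLeast_neq_bot[of x] tendsto_lowerbound
  by (auto simp: has_field_derivative_iff)

lemma deriv_within_atLeast_unique: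
  fixes f :: "real \<Rightarrow> 'a::real_normed_vector"
  assumes "(f has_vector_derivative D) (at x within {0..})" "(f has_vector_derivative D') (at x within {0..})"
    "0 \<le> x"
  shows "D = D'"
  using vector_derivative_unique_within[OF at_within_atLeast_neq_bot[OF assms(3)] assms(1,2)] .

lemma deriv_nn_nonneg:
  assumes "strict_mono_on {0..} f" "f differentiable_on {0..}" "0 \<le> x"
  shows "0 \<le> deriv_nn f x"
proof (rule deriv_within_atLeast_nonneg)
  have "0 \<le> (f y - f x) / (y - x)" if "0 \<le> y" "y \<noteq> x" for y
  proof (cases "y < x")
    case True
    then have "f y < f x"
      using strict_mono_onD[OF assms(1)] that assms(3) by simp
    with True show ?thesis by (simp add: divide_nonpos_neg)
  next
    case False
    then have "f x < f y"
      using strict_mono_onD[OF assms(1)] that assms(3) by simp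
    with False show ?thesis by simp
  qed
  then show "\<forall>\<^sub>F y in at x within {0..}. 0 \<le> (f y - f x) / (y - x)"
    by (auto simp: eventually_at_filter)
qed (use assms deriv_nn_has_real_derivative in auto)

text \<open>To the right of \<open>x\<close> all difference quotients are nonpositive, which bounds
  \<open>D\<close>; at an interior maximum the derivative vanishes by Fermat's criterion.\<close>

lemma foc_nn_maximum:
  assumes "(f has_real_derivative D) (at x within {0..})" "0 \<le> x"
    and max: "\<And>y. 0 \<le> y \<Longrightarrow> f y \<le> f x"
  shows "D \<le> 0" "0 < x \<Longrightarrow> D = 0"
proof -
  have "((\<lambda>y. (f y - f x) / (y - x)) \<longlongrightarrow> D) (at x within {0..})"
    using assms(1) by (simp add: has_field_derivative_iff)
  moreover have "at_right x \<le> at x within {0..}"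
    using assms(2) by (intro at_le) auto
  ultimately have "((\<lambda>y. (f y - f x) / (y - x)) \<longlongrightarrow> D) (at_right x)"
    by (rule tendsto_mono[rotated])
  moreover have "\<forall>\<^sub>F y in at_right x. (f y - f x) / (y - x) \<le> 0"
    using assms(2) by (intro eventually_at_rightI[of x "x + 1"] divide_nonpos_pos) (auto intro: max)
  ultimately show "D \<le> 0"
    by (rule tendsto_upperbound) (rule trivial_limit_at_right_real)
next
  assume "0 < x"
  then have "(f has_real_derivative D) (at x)"
    using assms(1) at_within_open_subset[of x "{0<..}" "{0..}"] by (simp add: subset_iff)
  moreover have "\<forall>y. \<bar>x - y\<bar> < x \<longrightarrow> f y \<le> f x"
    by (intro allI impI max) linarith
  ultimately show "D = 0"
    by (rule DERIV_local_max[OF _ \<open>0 < x\<close>])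
qed

text \<open>The filter omits the point 0, so \<open>f 0 = c\<close> is recovered from continuity.
  Equalities that hold only for small positive \<open>t\<close> can thus be differentiated at
  0.\<close>

lemma deriv_eq_zero_if_eventually_zero:
  fixes f :: "real \<Rightarrow> real"
  assumes "(f has_real_derivative D) (at 0 within {0..})"
    and "\<forall>\<^sub>F t in at 0 within {0..}. f t = c"
  shows "D = 0"
proof -
  have nb: "at (0::real) within {0..} \<noteq> bot"
    by (simp add: at_within_atLeast_neq_bot)
  have "(f \<longlongrightarrow> f 0) (at 0 within {0..})"
    using DERIV_continuous[OF assms(1)] by (simp add: continuous_within)
  moreover have "(f \<longlongrightarrow> c) (at 0 within {0..})"
    by (rule tendsto_eventually[OF assms(2)])
  ultimately have "f 0 = c"
    using nb tendsto_unique by blast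
  then have "\<forall>\<^sub>F t in at 0 within {0..}. (f t - f 0) / (t - 0) = 0"
    using assms(2) by (auto elim: eventually_mono)
  then have "((\<lambda>t. (f t - f 0) / (t - 0)) \<longlongrightarrow> 0) (at 0 within {0..})"
    by (rule tendsto_eventually)
  moreover have "((\<lambda>t. (f t - f 0) / (t - 0)) \<longlongrightarrow> D) (at 0 within {0..})"
    using assms(1) by (simp add: has_field_derivative_iff)
  ultimately show ?thesis
    using nb tendsto_unique by blast
qed

section \<open>First-order conditions of the agents\<close>

lemma game_primitives:
  assumes "valid_game \<Gamma>"
  shows "0 < ben \<Gamma> k" "0 < rho \<Gamma>"
    and "acost \<Gamma> k differentiable_on {0..}" "deriv_nn (acost \<Gamma> k) differentiable_on {0..}"
      "deriv_nn (acost \<Gamma> k) 0 = 0"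
    and "k \<noteq> l \<Longrightarrow> lsv \<Gamma> k l = lsv \<Gamma> l k"
    and "k \<noteq> l \<Longrightarrow> lcost \<Gamma> k l differentiable_on {0..}"
      "k \<noteq> l \<Longrightarrow> deriv_nn (lcost \<Gamma> k l) differentiable_on {0..}"
      "k \<noteq> l \<Longrightarrow> deriv_nn (lcost \<Gamma> k l) 0 = 0"
    and "k \<noteq> l \<Longrightarrow> 0 \<le> x \<Longrightarrow> lcost \<Gamma> k l x = lcost \<Gamma> l k x"
    and "k \<noteq> l \<Longrightarrow> pay \<Gamma> k l differentiable_on {0..}"
      "k \<noteq> l \<Longrightarrow> deriv_nn (pay \<Gamma> k l) differentiable_on {0..}"
      "k \<noteq> l \<Longrightarrow> 0 \<le> x \<Longrightarrow> 0 \<le> pay \<Gamma> k l x"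
      "k \<noteq> l \<Longrightarrow> 0 < x \<Longrightarrow> 0 < pay \<Gamma> k l x"
      "k \<noteq> l \<Longrightarrow> 0 \<le> x \<Longrightarrow> 0 \<le> deriv_nn (pay \<Gamma> k l) x"
proof -
  note defs = valid_game_def cost_function_def payoff_function_def twice_differentiable_nn_def
  show "0 < ben \<Gamma> k" "0 < rho \<Gamma>"
    "acost \<Gamma> k differentiable_on {0..}" "deriv_nn (acost \<Gamma> k) differentiable_on {0..}"
      "deriv_nn (acost \<Gamma> k) 0 = 0"
    using assms by (auto simp: defs)
  assume "k \<noteq> l"
  then show "lsv \<Gamma> k l = lsv \<Gamma> l k" "lcost \<Gamma> k l differentiable_on {0..}"
      "deriv_nn (lcost \<Gamma> k l) differentiable_on {0..}" "deriv_nn (lcost \<Gamma> k l) 0 = 0"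
      "0 \<le> x \<Longrightarrow> lcost \<Gamma> k l x = lcost \<Gamma> l k x"
      "pay \<Gamma> k l differentiable_on {0..}" "deriv_nn (pay \<Gamma> k l) differentiable_on {0..}"
      "0 \<le> x \<Longrightarrow> 0 \<le> pay \<Gamma> k l x"
    using assms by (auto simp: defs)
  have "strict_mono_on {0..} (pay \<Gamma> k l)" "pay \<Gamma> k l 0 = 0"
    using assms \<open>k \<noteq> l\<close> by (auto simp: defs)
  then show "0 < x \<Longrightarrow> 0 < pay \<Gamma> k l x"
    by (metis atLeast_iff less_imp_le order_refl strict_mono_onD)
  show "0 \<le> x \<Longrightarrow> 0 \<le> deriv_nn (pay \<Gamma> k l) x"
    using deriv_nn_nonneg \<open>strict_mono_on {0..} (pay \<Gamma> k l)\<close> \<open>pay \<Gamma> k l differentiable_on {0..}\<close>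
    by blast
qed

lemma vec_upd_nth [simp]: "vec_upd v i x $ k = (if k = i then x else v $ k)"
  by (simp add: vec_upd_def)

lemma vec_upd_same [simp]: "vec_upd v i (v $ i) = v"
  by (simp add: vec_eq_iff)

lemma nonneg_vecmatsD:
  assumes "p \<in> nonneg_vecmats"
  shows "0 \<le> fst p $ k" "0 \<le> snd p $ k $ l" "snd p $ k $ k = 0" "0 \<le> link (snd p) k l"
  using assms by (auto simp: nonneg_vecmats_def link_def)

text \<open>Minus the derivative of \<open>base_utility\<close> in the own action: the action
  subsidy at which an interior action is stationary.\<close>

definition marginal_action_cost :: "('n::finite) network_game \<Rightarrow> 'n \<Rightarrow> 'n vecmat \<Rightarrow> real" where
  "marginal_action_cost \<Gamma> k p = deriv_nn (acost \<Gamma> k) (fst p $ k) - ben \<Gamma> k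
     - rho \<Gamma> * (\<Sum>l\<in>UNIV - {k}. link (snd p) k l *
         deriv_nn (pay \<Gamma> k l) (fst p $ k) * pay \<Gamma> l k (fst p $ l))"

text \<open>The analogue for one own link intensity. It depends on no other intensity, which keeps
  its derivative simple.\<close>

definition marginal_link_cost :: "('n::finite) network_game \<Rightarrow> 'n \<Rightarrow> 'n \<Rightarrow> 'n vecmat \<Rightarrow> real" where
  "marginal_link_cost \<Gamma> k l p = deriv_nn (lcost \<Gamma> k l) (snd p $ k $ l) - lsv \<Gamma> k l
     - rho \<Gamma> * (pay \<Gamma> k l (fst p $ k) * pay \<Gamma> l k (fst p $ l))"

lemma nash_action_foc:
  assumes "valid_game \<Gamma>" "nash \<Gamma> s p" "s \<in> nonneg_vecmats"
  shows "0 < fst p $ k" "fst s $ k = marginal_action_cost \<Gamma> k p"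
proof -
  note gp = game_primitives[OF assms(1)]
  let ?a = "fst p" and ?g = "snd p"
  have pN: "p \<in> nonneg_vecmats" using assms(2) by (simp add: nash_def)
  note nn = nonneg_vecmatsD[OF pN]
  let ?f = "\<lambda>x. utility \<Gamma> s k (deviation p k x (?g $ k))"
  define S where "S x = (\<Sum>l\<in>UNIV - {k}. link ?g k l * pay \<Gamma> k l x * pay \<Gamma> l k (?a $ l))" for x
  let ?S' = "\<Sum>l\<in>UNIV - {k}. link ?g k l * deriv_nn (pay \<Gamma> k l) (?a $ k) * pay \<Gamma> l k (?a $ l)"
  have S: "(S has_real_derivative ?S') (at (?a $ k) within {0..})"
    unfolding S_def
  proof (rule DERIV_sum)
    show "((\<lambda>x. link ?g k l * pay \<Gamma> k l x * pay \<Gamma> l k (?a $ l)) has_real_derivative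
        link ?g k l * deriv_nn (pay \<Gamma> k l) (?a $ k) * pay \<Gamma> l k (?a $ l)) (at (?a $ k) within {0..})"
      if "l \<in> UNIV - {k}" for l
      using that deriv_nn_has_real_derivative[OF gp(11)[of k l] nn(1)[of k]]
      by (intro DERIV_cmult_right DERIV_cmult) auto
  qed
  have "?f = (\<lambda>x. ben \<Gamma> k * x + rho \<Gamma> * S x - acost \<Gamma> k x
     + (\<Sum>l\<in>UNIV - {k}. lsv \<Gamma> k l * link ?g k l)
     - (\<Sum>l\<in>UNIV - {k}. lcost \<Gamma> k l (?g $ k $ l))
     + (fst s $ k * x + (\<Sum>l\<in>UNIV - {k}. snd s $ k $ l * link ?g k l)))"
    by (simp add: S_def utility_def base_utility_def transfer_def deviation_def split_beta fun_eq_iff)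
  moreover have "(\<dots> has_real_derivative
      ben \<Gamma> k + rho \<Gamma> * ?S' - deriv_nn (acost \<Gamma> k) (?a $ k) + fst s $ k) (at (?a $ k) within {0..})"
    by (auto intro!: derivative_eq_intros S deriv_nn_has_real_derivative gp(3) nn(1))
  ultimately have der: "(?f has_real_derivative fst s $ k - marginal_action_cost \<Gamma> k p) (at (?a $ k) within {0..})"
    by (simp add: marginal_action_cost_def algebra_simps)
  have max: "?f y \<le> ?f (?a $ k)" if "0 \<le> y" for y
  proof -
    have "deviation p k (?a $ k) (?g $ k) = p"
      by (simp add: deviation_def)
    moreover have "deviation p k y (?g $ k) \<in> nonneg_vecmats"
      using that nn by (auto simp: deviation_def nonneg_vecmats_def)
    ultimately show ?thesis
      using assms(2) by (simp add: nash_def)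
  qed
  note foc = foc_nn_maximum[OF der nn(1) max]
  \<comment> \<open>At a zero action the marginal cost vanishes, while
    \<open>ben \<Gamma> k > 0\<close> and the remaining returns are nonnegative, so a small increase
    would pay.\<close>
  show pos: "0 < ?a $ k"
  proof (rule ccontr)
    assume "\<not> 0 < ?a $ k"
    with nn(1)[of k] have 0: "?a $ k = 0" by simp
    have "0 \<le> rho \<Gamma> * (\<Sum>l\<in>UNIV - {k}. link ?g k l * deriv_nn (pay \<Gamma> k l) (?a $ k) * pay \<Gamma> l k (?a $ l))"
      by (intro mult_nonneg_nonneg sum_nonneg) (auto intro!: gp nn less_imp_le[OF gp(2)])
    then have "0 < fst s $ k - marginal_action_cost \<Gamma> k p"
      using gp(1)[of k] gp(5)[of k] nonneg_vecmatsD(1)[OF assms(3), of k]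
      by (simp add: marginal_action_cost_def 0)
    with foc(1) show False by simp
  qed
  show "fst s $ k = marginal_action_cost \<Gamma> k p"
    using foc(2) pos by simp
qed

lemma nash_link_foc:
  assumes "valid_game \<Gamma>" "nash \<Gamma> s p" "k \<noteq> l"
  shows "snd s $ k $ l \<le> marginal_link_cost \<Gamma> k l p"
    and "0 < snd p $ k $ l \<Longrightarrow> snd s $ k $ l = marginal_link_cost \<Gamma> k l p"
proof -
  note gp = game_primitives[OF assms(1)]
  let ?a = "fst p" and ?g = "snd p"
  have pN: "p \<in> nonneg_vecmats" using assms(2) by (simp add: nash_def)
  note nn = nonneg_vecmatsD[OF pN]
  let ?d = "\<lambda>y. deviation p k (?a $ k) (vec_upd (?g $ k) l y)"
  let ?f = "\<lambda>y. utility \<Gamma> s k (?d y)"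
  let ?c = "\<lambda>m. rho \<Gamma> * pay \<Gamma> k m (?a $ k) * pay \<Gamma> m k (?a $ m) + lsv \<Gamma> k m + snd s $ k $ m"
  \<comment> \<open>Changing one intensity leaves the terms of the other links untouched. With these
    collected in \<open>R\<close>, the utility is affine in \<open>y\<close> minus the cost of this
    link.\<close>
  define R where "R = (\<Sum>m\<in>UNIV - {k} - {l}. ?c m * link ?g k m - lcost \<Gamma> k m (?g $ k $ m))"
  have f: "?f y = ?f 0 + ?c l * y - (lcost \<Gamma> k l y - lcost \<Gamma> k l 0)" for y
  proof -
    have 1: "?f x = ben \<Gamma> k * ?a $ k - acost \<Gamma> k (?a $ k) + fst s $ k * ?a $ k
       + (\<Sum>m\<in>UNIV - {k}. ?c m * link (snd (?d x)) k m - lcost \<Gamma> k m (snd (?d x) $ k $ m))" for x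
      by (simp add: utility_def base_utility_def transfer_def split_beta deviation_def
          sum.distrib sum_subtractf sum_distrib_left algebra_simps )
    have 2: "(\<Sum>m\<in>UNIV - {k}. ?c m * link (snd (?d x)) k m - lcost \<Gamma> k m (snd (?d x) $ k $ m))
        = ?c l * (x + ?g $ l $ k) - lcost \<Gamma> k l x
          + R" for x
    proof -
      have "(\<Sum>m\<in>UNIV - {k} - {l}. ?c m * link (snd (?d x)) k m - lcost \<Gamma> k m (snd (?d x) $ k $ m))
        = (\<Sum>m\<in>UNIV - {k} - {l}. ?c m * link ?g k m - lcost \<Gamma> k m (?g $ k $ m))"
        by (rule sum.cong) (auto simp: deviation_def link_def)
      then show ?thesis
        using assms(3) by (subst sum.remove[of _ l]) (auto simp: deviation_def link_def R_def)
    qed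
    show ?thesis
      unfolding 1 2 by (simp add: algebra_simps)
  qed
  have "((\<lambda>y. ?f 0 + ?c l * y - (lcost \<Gamma> k l y - lcost \<Gamma> k l 0)) has_real_derivative
      ?c l - deriv_nn (lcost \<Gamma> k l) (?g $ k $ l)) (at (?g $ k $ l) within {0..})"
    by (rule derivative_eq_intros deriv_nn_has_real_derivative gp nn assms | force)+
  then have der: "(?f has_real_derivative snd s $ k $ l - marginal_link_cost \<Gamma> k l p) (at (?g $ k $ l) within {0..})"
    by (subst f) (simp add: marginal_link_cost_def algebra_simps)
  have max: "?f y \<le> ?f (?g $ k $ l)" if "0 \<le> y" for y
  proof -
    have "?d (?g $ k $ l) = p"
      by (simp add: deviation_def)
    moreover have "?d y \<in> nonneg_vecmats"
      using that nn assms(3) by (auto simp: deviation_def nonneg_vecmats_def)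
    ultimately show ?thesis
      using assms(2) by (simp add: nash_def)
  qed
  note foc = foc_nn_maximum[OF der nn(2) max]
  show "snd s $ k $ l \<le> marginal_link_cost \<Gamma> k l p"
    and "0 < snd p $ k $ l \<Longrightarrow> snd s $ k $ l = marginal_link_cost \<Gamma> k l p"
    using foc by auto
qed

section \<open>Differentiability of the marginal costs on the cone of profiles\<close>

lemma bounded_linear_action: "bounded_linear (\<lambda>p :: ('n::finite) vecmat. fst p $ k)"
  by (auto simp: linear_conv_bounded_linear[symmetric] intro!: linearI)

lemma bounded_linear_link: "bounded_linear (\<lambda>p :: ('n::finite) vecmat. snd p $ k $ l)"
  by (auto simp: linear_conv_bounded_linear[symmetric] intro!: linearI)

text \<open>\<open>h\<close> is differentiable only relative to the half-line, so the chain rule is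
  applied within the image of the cone, whose coordinates are nonnegative.\<close>

lemma differentiable_compose_action:
  assumes "h differentiable_on {0..}" "p \<in> nonneg_vecmats"
  shows "(\<lambda>p. h (fst p $ k)) differentiable (at p within nonneg_vecmats)"
proof -
  have "(\<lambda>p. fst p $ k) differentiable (at p within nonneg_vecmats)"
    by (intro bounded_linear_imp_differentiable bounded_linear_action)
  moreover have "h differentiable (at (fst p $ k) within (\<lambda>p. fst p $ k) ` nonneg_vecmats)"
  proof (rule differentiable_within_subset)
    show "h differentiable (at (fst p $ k) within {0..})"
      using assms(1) nonneg_vecmatsD[OF assms(2)] by (simp add: differentiable_on_def)
  qed (use nonneg_vecmatsD in auto)
  ultimately show ?thesis
    using differentiable_chain_within[of "\<lambda>p. fst p $ k" p nonneg_vecmats h] by (simp add: o_def)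
qed

lemma differentiable_compose_link:
  assumes "h differentiable_on {0..}" "p \<in> nonneg_vecmats"
  shows "(\<lambda>p. h (snd p $ k $ l)) differentiable (at p within nonneg_vecmats)"
proof -
  have "(\<lambda>p. snd p $ k $ l) differentiable (at p within nonneg_vecmats)"
    by (intro bounded_linear_imp_differentiable bounded_linear_link)
  moreover have "h differentiable (at (snd p $ k $ l) within (\<lambda>p. snd p $ k $ l) ` nonneg_vecmats)"
  proof (rule differentiable_within_subset)
    show "h differentiable (at (snd p $ k $ l) within {0..})"
      using assms(1) nonneg_vecmatsD[OF assms(2)] by (simp add: differentiable_on_def)
  qed (use nonneg_vecmatsD in auto)
  ultimately show ?thesis
    using differentiable_chain_within[of "\<lambda>p. snd p $ k $ l" p nonneg_vecmats h] by (simp add: o_def)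
qed

lemma marginal_action_cost_differentiable:
  assumes "valid_game \<Gamma>" "p \<in> nonneg_vecmats"
  shows "marginal_action_cost \<Gamma> k differentiable (at p within nonneg_vecmats)"
proof -
  note gp = game_primitives[OF assms(1)]
  have "(\<lambda>p. link (snd p) k l) differentiable (at p within nonneg_vecmats)" for l
    unfolding link_def
    by (intro bounded_linear_imp_differentiable bounded_linear_add bounded_linear_link)
  then have "(\<lambda>p. link (snd p) k l * deriv_nn (pay \<Gamma> k l) (fst p $ k) * pay \<Gamma> l k (fst p $ l))
      differentiable (at p within nonneg_vecmats)" if "l \<in> UNIV - {k}" for l
    using that by (intro differentiable_mult differentiable_compose_action gp assms) auto
  then show ?thesis
    unfolding marginal_action_cost_def[abs_def]
    by (intro differentiable_diff differentiable_mult differentiable_const differentiable_sum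
        differentiable_compose_action gp assms finite_Diff finite) auto
qed

lemma marginal_link_cost_differentiable:
  assumes "valid_game \<Gamma>" "p \<in> nonneg_vecmats" "k \<noteq> l"
  shows "marginal_link_cost \<Gamma> k l differentiable (at p within nonneg_vecmats)"
  unfolding marginal_link_cost_def[abs_def]
  using assms(3)
  by (intro derivative_intros differentiable_compose_action differentiable_compose_link
      game_primitives[OF assms(1)] assms) auto

section \<open>One-sided derivatives along rays of the cone\<close>

lemma nonneg_vecmats_ray:
  assumes "p \<in> nonneg_vecmats" "v \<in> nonneg_vecmats" "0 \<le> t"
  shows "p + t *\<^sub>R v \<in> nonneg_vecmats"
  using assms by (auto simp: nonneg_vecmats_def)

lemma nonneg_vecmats_zero: "0 \<in> nonneg_vecmats"
  by (simp add: nonneg_vecmats_def zero_prod_def)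

text \<open>Positive and negative parts. The cone thus spans all zero-diagonal vectors, and linear
  identities on the cone extend to them.\<close>

lemma nonneg_vecmats_diff:
  fixes v :: "('n::finite) vecmat"
  assumes "\<And>k. snd v $ k $ k = 0"
  obtains x y where "x \<in> nonneg_vecmats" "y \<in> nonneg_vecmats" "v = x - y"
proof
  let ?P = "\<lambda>v :: 'n vecmat. (\<chi> k. max 0 (fst v $ k), \<chi> k l. max 0 (snd v $ k $ l))"
  show "?P v \<in> nonneg_vecmats" "?P (- v) \<in> nonneg_vecmats"
    using assms by (auto simp: nonneg_vecmats_def)
  show "v = ?P v - ?P (- v)"
    by (auto simp: prod_eq_iff vec_eq_iff max_def)
qed

lemma directional_derivative:
  assumes "(E has_derivative A) (at p within nonneg_vecmats)"
    and "p \<in> nonneg_vecmats" "v \<in> nonneg_vecmats"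
  shows "((\<lambda>t. E (p + t *\<^sub>R v)) has_vector_derivative A v) (at 0 within {0..})"
proof -
  have "((\<lambda>t. p + t *\<^sub>R v) has_vector_derivative v) (at 0 within {0..})"
    by (auto intro!: derivative_eq_intros)
  moreover have "(E has_derivative A) (at (p + 0 *\<^sub>R v) within (\<lambda>t. p + t *\<^sub>R v) ` {0..})"
    by (rule has_derivative_subset) (use assms nonneg_vecmats_ray[OF assms(2,3)] in auto)
  ultimately show ?thesis
    using vector_derivative_diff_chain_within by (fastforce simp: o_def)
qed

text \<open>With actions frozen the marginal action cost is affine along the ray, so its slope can
  be read off; one-sided derivatives are unique.\<close>

lemma marginal_action_cost_derivative_link:
  assumes "(marginal_action_cost \<Gamma> k has_derivative A) (at p within nonneg_vecmats)"
    and "p \<in> nonneg_vecmats" "v \<in> nonneg_vecmats" "fst v = 0"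
  shows "A v = - rho \<Gamma> * (\<Sum>l\<in>UNIV - {k}. link (snd v) k l *
         deriv_nn (pay \<Gamma> k l) (fst p $ k) * pay \<Gamma> l k (fst p $ l))" (is "_ = - _ * ?S")
proof (rule deriv_within_atLeast_unique)
  show "((\<lambda>t. marginal_action_cost \<Gamma> k (p + t *\<^sub>R v)) has_vector_derivative A v) (at 0 within {0..})"
    using directional_derivative assms by blast
  have "marginal_action_cost \<Gamma> k (p + t *\<^sub>R v) = marginal_action_cost \<Gamma> k p - rho \<Gamma> * (t * ?S)" for t
    using assms(4)
    by (simp add: marginal_action_cost_def link_def sum_distrib_left sum.distrib algebra_simps)
  then show "((\<lambda>t. marginal_action_cost \<Gamma> k (p + t *\<^sub>R v)) has_vector_derivative - rho \<Gamma> * ?S) (at 0 within {0..})"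
    unfolding has_real_derivative_iff_has_vector_derivative[symmetric]
    by (auto intro!: derivative_eq_intros)
qed simp

text \<open>With actions frozen only the term \<open>F'\<close> varies, and only through the
  intensity of this one link.\<close>

lemma marginal_link_cost_derivative_link:
  assumes "(marginal_link_cost \<Gamma> k l has_derivative A) (at p within nonneg_vecmats)"
    and "valid_game \<Gamma>" "k \<noteq> l"
    and "p \<in> nonneg_vecmats" "v \<in> nonneg_vecmats" "fst v = 0"
  shows "A v = deriv_nn (deriv_nn (lcost \<Gamma> k l)) (snd p $ k $ l) * snd v $ k $ l"
proof (rule deriv_within_atLeast_unique)
  let ?F = "deriv_nn (lcost \<Gamma> k l)"
  let ?r = "\<lambda>t. snd p $ k $ l + t * snd v $ k $ l"
  note nn = nonneg_vecmatsD(2)[OF assms(4), of k l] nonneg_vecmatsD(2)[OF assms(5), of k l]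
  show "((\<lambda>t. marginal_link_cost \<Gamma> k l (p + t *\<^sub>R v)) has_vector_derivative A v) (at 0 within {0..})"
    using directional_derivative assms by blast
  have "(?r has_real_derivative snd v $ k $ l) (at 0 within {0..})"
    by (auto intro!: derivative_eq_intros)
  moreover have "(?F has_real_derivative deriv_nn ?F (snd p $ k $ l)) (at (?r 0) within ?r ` {0..})"
    using DERIV_subset[OF deriv_nn_has_real_derivative[OF game_primitives(8)[OF assms(2,3)] nn(1)]] nn
    by (simp add: image_subset_iff)
  ultimately have "((\<lambda>t. ?F (?r t)) has_real_derivative deriv_nn ?F (snd p $ k $ l) * snd v $ k $ l) (at 0 within {0..})"
    using DERIV_image_chain by (fastforce simp: o_def)
  moreover have "marginal_link_cost \<Gamma> k l (p + t *\<^sub>R v) = ?F (?r t) + (marginal_link_cost \<Gamma> k l p - ?F (snd p $ k $ l))" for t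
    using assms(6) by (simp add: marginal_link_cost_def)
  ultimately show "((\<lambda>t. marginal_link_cost \<Gamma> k l (p + t *\<^sub>R v)) has_vector_derivative
      deriv_nn ?F (snd p $ k $ l) * snd v $ k $ l) (at 0 within {0..})"
    unfolding has_real_derivative_iff_has_vector_derivative[symmetric]
    by (auto intro!: derivative_eq_intros)
qed simp

lemma bounded_bilinear_payment: "bounded_bilinear payment"
proof -
  have "bilinear payment"
    unfolding bilinear_def payment_def[abs_def] transfer_def link_def
    by (auto intro!: linearI
        simp: split_beta sum.distrib sum_distrib_left algebra_simps)
  then show ?thesis
    by (simp add: bilinear_conv_bounded_bilinear)
qed

text \<open>Moves the base point to 0 and keeps the right-hand derivative, so that the condition can
  be compared with derivatives along rays.\<close>

lemma foc_nn_shift: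
  assumes "foc_nn f x" "0 \<le> x"
  obtains D where "((\<lambda>t. f (x + t)) has_real_derivative D) (at 0 within {0..})"
    "D \<le> 0" "0 < x \<Longrightarrow> D = 0"
proof -
  obtain D where D: "(f has_real_derivative D) (at x within {0..})" "D \<le> 0" "0 < x \<Longrightarrow> D = 0"
    using assms(1) by (auto simp: foc_nn_def)
  have "((\<lambda>t. x + t) has_real_derivative 1) (at 0 within {0..})"
    by (auto intro!: derivative_eq_intros)
  moreover have "(f has_real_derivative D) (at (x + 0) within (\<lambda>t. x + t) ` {0..})"
    using DERIV_subset[OF D(1)] assms(2) by auto
  ultimately have "((\<lambda>t. f (x + t)) has_real_derivative D) (at 0 within {0..})"
    using DERIV_image_chain[of f D "(+) x" 0 "{0..}" 1] by (simp add: o_def)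
  with D that show thesis by blast
qed

section \<open>The derivative of the equilibrium selection\<close>

text \<open>\<open>X\<close> is a derivative relative to a cone whose elements have zero diagonal.
  It is controlled only on zero-diagonal directions, whence the diagonal hypotheses below.\<close>

locale differentiable_selection =
  fixes \<Gamma> :: "('n::finite) network_game"
    and sel :: "'n vecmat \<Rightarrow> 'n vecmat"
    and \<theta> :: "'n vecmat"
    and X :: "'n vecmat \<Rightarrow> 'n vecmat"
  assumes valid: "valid_game \<Gamma>"
    and selection: "equilibrium_selection \<Gamma> sel"
    and subsidy: "\<theta> \<in> nonneg_vecmats"
    and near: "\<exists>U. open U \<and> \<theta> \<in> U \<and> (\<forall>t \<in> U \<inter> nonneg_vecmats. has_nash \<Gamma> t)"
    and deriv: "(sel has_derivative X) (at \<theta> within nonneg_vecmats)"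
begin

lemma linear_X: "linear X"
  using deriv has_derivative_linear by blast

lemma nash_near:
  assumes "v \<in> nonneg_vecmats"
  obtains d where "0 < d"
    "\<And>t. 0 \<le> t \<Longrightarrow> t \<le> d \<Longrightarrow> nash \<Gamma> (\<theta> + t *\<^sub>R v) (sel (\<theta> + t *\<^sub>R v))"
proof -
  obtain U where U: "open U" "\<theta> \<in> U" "\<And>t. t \<in> U \<Longrightarrow> t \<in> nonneg_vecmats \<Longrightarrow> has_nash \<Gamma> t"
    using near by auto
  have "((\<lambda>t. \<theta> + t *\<^sub>R v) \<longlongrightarrow> \<theta> + 0 *\<^sub>R v) (at_right 0)"
    by (intro tendsto_intros)
  then have "\<forall>\<^sub>F t in at_right 0. \<theta> + t *\<^sub>R v \<in> U"
    using U(1,2) topological_tendstoD by fastforce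
  then obtain d where d: "0 < d" "\<And>t. 0 < t \<Longrightarrow> t < d \<Longrightarrow> \<theta> + t *\<^sub>R v \<in> U"
    by (auto simp: eventually_at_right_field)
  show thesis
  proof (rule that[of "d / 2"])
    fix t :: real
    assume t: "0 \<le> t" "t \<le> d / 2"
    then have "\<theta> + t *\<^sub>R v \<in> U"
      using d U(2) by (cases "t = 0") auto
    then show "nash \<Gamma> (\<theta> + t *\<^sub>R v) (sel (\<theta> + t *\<^sub>R v))"
      using U(3) nonneg_vecmats_ray[OF subsidy assms t(1)] selection
      by (auto simp: equilibrium_selection_def)
  qed (use d in auto)
qed

lemma eventually_nash:
  assumes "v \<in> nonneg_vecmats"
  shows "\<forall>\<^sub>F t in at 0 within {0..}.
    0 < t \<and> nash \<Gamma> (\<theta> + t *\<^sub>R v) (sel (\<theta> + t *\<^sub>R v)) \<and> sel (\<theta> + t *\<^sub>R v) \<in> nonneg_vecmats"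
proof -
  obtain d where "0 < d"
    "\<And>t. 0 \<le> t \<Longrightarrow> t \<le> d \<Longrightarrow> nash \<Gamma> (\<theta> + t *\<^sub>R v) (sel (\<theta> + t *\<^sub>R v))"
    using nash_near[OF assms] by blast
  then show ?thesis
    by (auto simp: eventually_at dist_real_def nash_def intro!: exI[of _ d])
qed

lemma nash_at: "nash \<Gamma> \<theta> (sel \<theta>)"
proof -
  obtain d where "0 < d" "\<And>t. 0 \<le> t \<Longrightarrow> t \<le> d \<Longrightarrow> nash \<Gamma> (\<theta> + t *\<^sub>R 0) (sel (\<theta> + t *\<^sub>R 0))"
    using nash_near[OF nonneg_vecmats_zero] by blast
  from this(2)[of 0] this(1) show ?thesis by simp
qed

lemma sel_nonneg: "sel \<theta> \<in> nonneg_vecmats"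
  using nash_at by (simp add: nash_def)

lemma ray_derivative:
  assumes "v \<in> nonneg_vecmats"
  shows "((\<lambda>t. sel (\<theta> + t *\<^sub>R v)) has_vector_derivative X v) (at 0 within {0..})"
  using directional_derivative[OF deriv subsidy assms] .

lemma ray_chain:
  fixes E :: "'n vecmat \<Rightarrow> real"
  assumes "(E has_derivative A) (at (sel \<theta>) within nonneg_vecmats)" "v \<in> nonneg_vecmats"
  shows "((\<lambda>t. E (sel (\<theta> + t *\<^sub>R v))) has_real_derivative A (X v)) (at 0 within {0..})"
proof -
  obtain d where d: "0 < d"
    "\<And>t. 0 \<le> t \<Longrightarrow> t \<le> d \<Longrightarrow> nash \<Gamma> (\<theta> + t *\<^sub>R v) (sel (\<theta> + t *\<^sub>R v))"
    using nash_near[OF assms(2)] by blast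
  \<comment> \<open>Only for \<open>t \<le> d\<close> is the selected profile known to lie in the
    cone on which \<open>E\<close> is differentiated. The interval is widened again at the end,
    derivatives being local.\<close>
  have "((\<lambda>t. sel (\<theta> + t *\<^sub>R v)) has_vector_derivative X v) (at 0 within {0..d})"
    using ray_derivative[OF assms(2)] has_vector_derivative_within_subset by fastforce
  moreover have "(E has_derivative A) (at (sel (\<theta> + 0 *\<^sub>R v)) within (\<lambda>t. sel (\<theta> + t *\<^sub>R v)) ` {0..d})"
    by (rule has_derivative_subset) (use assms(1) d(2) in \<open>auto simp: nash_def\<close>)
  ultimately have "((\<lambda>t. E (sel (\<theta> + t *\<^sub>R v))) has_vector_derivative A (X v)) (at 0 within {0..d})"
    using vector_derivative_diff_chain_within by (fastforce simp: o_def)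
  moreover have "at (0::real) within {0..d} = at 0 within {0..}"
    using d(1) by (intro at_within_nhd[of 0 "{..<d}"]) auto
  ultimately show ?thesis
    by (simp add: has_real_derivative_iff_has_vector_derivative)
qed

text \<open>Along the ray \<open>q\<close> is affine in \<open>t\<close>, so the difference of the
  two sides is differentiable and vanishes for small positive \<open>t\<close>; hence its derivative
  is 0.\<close>

lemma tangent:
  fixes E :: "'n vecmat \<Rightarrow> real"
  assumes "(E has_derivative A) (at (sel \<theta>) within nonneg_vecmats)" "v \<in> nonneg_vecmats"
    and "linear q" "\<forall>\<^sub>F t in at 0 within {0..}. E (sel (\<theta> + t *\<^sub>R v)) = q (\<theta> + t *\<^sub>R v)"
  shows "A (X v) = q v"
proof -
  have q: "q (\<theta> + t *\<^sub>R v) = q \<theta> + t * q v" for t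
    using assms(3) by (simp add: linear_add linear_scale)
  have "((\<lambda>t. E (sel (\<theta> + t *\<^sub>R v)) - (q \<theta> + t * q v)) has_real_derivative A (X v) - q v) (at 0 within {0..})"
    by (auto intro!: derivative_eq_intros ray_chain[OF assms(1,2)])
  moreover have "\<forall>\<^sub>F t in at 0 within {0..}. E (sel (\<theta> + t *\<^sub>R v)) - (q \<theta> + t * q v) = 0"
    using assms(4) by (simp add: q)
  ultimately show ?thesis
    using deriv_eq_zero_if_eventually_zero by fastforce
qed

lemma tangent_diff:
  fixes A q :: "'n vecmat \<Rightarrow> real"
  assumes "linear A" "linear q" "\<And>v. v \<in> nonneg_vecmats \<Longrightarrow> A (X v) = q v"
    and "\<And>k. snd v $ k $ k = 0"
  shows "A (X v) = q v"
proof -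
  obtain x y where "x \<in> nonneg_vecmats" "y \<in> nonneg_vecmats" "v = x - y"
    using nonneg_vecmats_diff[OF assms(4)] .
  then show ?thesis
    using assms(3)[of x] assms(3)[of y]
    by (simp add: linear_diff[OF linear_X] linear_diff[OF assms(1)] linear_diff[OF assms(2)])
qed

text \<open>Equilibrium actions are always positive, so their first-order conditions are equalities
  near \<open>\<theta>\<close>. Differentiating them recovers the change of the action subsidies
  from \<open>X v\<close>.\<close>

lemma action_tangent:
  assumes "(marginal_action_cost \<Gamma> k has_derivative A) (at (sel \<theta>) within nonneg_vecmats)"
    and "\<And>k. snd v $ k $ k = 0"
  shows "A (X v) = fst v $ k"
proof (rule tangent_diff[OF _ _ _ assms(2)])
  show lin: "linear (\<lambda>v. fst v $ k)"
    by (auto intro!: linearI)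
  show "A (X v) = fst v $ k" if "v \<in> nonneg_vecmats" for v
  proof (rule tangent[OF assms(1) that lin])
    show "\<forall>\<^sub>F t in at 0 within {0..}.
        marginal_action_cost \<Gamma> k (sel (\<theta> + t *\<^sub>R v)) = fst (\<theta> + t *\<^sub>R v) $ k"
      using eventually_nash[OF that]
      by eventually_elim
        (metis less_imp_le nash_action_foc(2)[OF valid] nonneg_vecmats_ray[OF subsidy that])
  qed
qed (use assms has_derivative_linear in blast)

text \<open>
  A link that is inactive at \<open>\<theta>\<close> may become active as soon as the subsidy moves into the cone, so the
  links whose first-order condition is an equality have to include those whose derivative does not
  vanish.
\<close>

definition active_links :: "('n \<times> 'n) set" where
  "active_links = {(k, l). k \<noteq> l \<and>
     (0 < snd (sel \<theta>) $ k $ l \<or> (\<exists>v\<in>nonneg_vecmats. snd (X v) $ k $ l \<noteq> 0))}"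

section \<open>Links along rays from \<open>\<theta>\<close>\<close>

lemma has_derivative_link:
  "((\<lambda>p :: 'n vecmat. snd p $ k $ l) has_derivative (\<lambda>p. snd p $ k $ l)) (at q within S)"
  by (intro bounded_linear_imp_has_derivative bounded_linear_link)

lemma self_link_tangent:
  assumes "v \<in> nonneg_vecmats"
  shows "snd (X v) $ k $ k = 0"
proof (rule tangent[OF has_derivative_link assms, of "\<lambda>v. 0"])
  show "\<forall>\<^sub>F t in at 0 within {0..}. snd (sel (\<theta> + t *\<^sub>R v)) $ k $ k = 0"
    using eventually_nash[OF assms] by eventually_elim (auto dest: nonneg_vecmatsD)
qed (auto intro!: linearI)

text \<open>The link starts at its lower bound 0, so its difference quotients are
  nonnegative.\<close>

lemma link_tangent_nonneg:
  assumes "v \<in> nonneg_vecmats" "snd (sel \<theta>) $ k $ l = 0"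
  shows "0 \<le> snd (X v) $ k $ l"
proof (rule deriv_within_atLeast_nonneg)
  show "((\<lambda>t. snd (sel (\<theta> + t *\<^sub>R v)) $ k $ l) has_real_derivative snd (X v) $ k $ l) (at 0 within {0..})"
    by (rule ray_chain[OF has_derivative_link assms(1)])
  show "\<forall>\<^sub>F t in at 0 within {0..}.
      0 \<le> (snd (sel (\<theta> + t *\<^sub>R v)) $ k $ l - snd (sel (\<theta> + 0 *\<^sub>R v)) $ k $ l) / (t - 0)"
    using eventually_nash[OF assms(1)] by eventually_elim (simp add: assms(2) nonneg_vecmatsD)
qed simp

text \<open>A link that is positive at \<open>\<theta>\<close> stays so by continuity; otherwise it
  starts at 0 and its difference quotients have a positive limit.\<close>

lemma eventually_link_positive:
  assumes "v \<in> nonneg_vecmats" "0 < snd (sel \<theta>) $ k $ l \<or> 0 < snd (X v) $ k $ l"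
  shows "\<forall>\<^sub>F t in at 0 within {0..}. 0 < snd (sel (\<theta> + t *\<^sub>R v)) $ k $ l"
proof (cases "0 < snd (sel \<theta>) $ k $ l")
  let ?g = "\<lambda>t. snd (sel (\<theta> + t *\<^sub>R v)) $ k $ l"
  have der: "(?g has_real_derivative snd (X v) $ k $ l) (at 0 within {0..})"
    by (rule ray_chain[OF has_derivative_link assms(1)])
  {
    case True
    have "(?g \<longlongrightarrow> ?g 0) (at 0 within {0..})"
      using DERIV_continuous[OF der] by (simp add: continuous_within)
    with True show ?thesis
      by (intro order_tendstoD(1)) auto
  next
    case False
    then have 0: "snd (sel \<theta>) $ k $ l = 0"
      using nonneg_vecmatsD(2)[OF sel_nonneg, of k l] by simp
    have "((\<lambda>t. (?g t - ?g 0) / (t - 0)) \<longlongrightarrow> snd (X v) $ k $ l) (at 0 within {0..})"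
      using der by (simp add: has_field_derivative_iff)
    then have "\<forall>\<^sub>F t in at 0 within {0..}. 0 < (?g t - ?g 0) / (t - 0)"
      using False assms(2) by (intro order_tendstoD(1)) auto
    then show ?thesis
      using eventually_nash[OF assms(1)]
      by eventually_elim (auto simp: 0 zero_less_divide_iff)
  }
qed

text \<open>Differentiates the link first-order condition, which is known to be an equality only
  where the link is positive.\<close>

lemma link_tangent:
  assumes "(k, l) \<in> active_links"
    and "(marginal_link_cost \<Gamma> k l has_derivative A) (at (sel \<theta>) within nonneg_vecmats)"
    and "\<And>k. snd v $ k $ k = 0"
  shows "A (X v) = snd v $ k $ l"
proof (rule tangent_diff[OF _ _ _ assms(3)])
  show lin: "linear (\<lambda>v. snd v $ k $ l)"
    by (auto intro!: linearI)
  show linA: "linear A"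
    using assms has_derivative_linear by blast
  have kl: "k \<noteq> l"
    using assms(1) by (simp add: active_links_def)
  \<comment> \<open>On an inactive link all derivatives along the cone are nonnegative, so if one of them is positive,
    it can be added to any other direction to make the link active along the sum.\<close>
  have pos: "A (X v) = snd v $ k $ l"
    if "v \<in> nonneg_vecmats" "0 < snd (sel \<theta>) $ k $ l \<or> 0 < snd (X v) $ k $ l" for v
  proof (rule tangent[OF assms(2) that(1) lin])
    show "\<forall>\<^sub>F t in at 0 within {0..}.
        marginal_link_cost \<Gamma> k l (sel (\<theta> + t *\<^sub>R v)) = snd (\<theta> + t *\<^sub>R v) $ k $ l"
      using eventually_nash[OF that(1)] eventually_link_positive[OF that]
      by eventually_elim (metis nash_link_foc(2)[OF valid _ kl])
  qed
  show "A (X v) = snd v $ k $ l" if v: "v \<in> nonneg_vecmats" for v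
  proof (cases "0 < snd (sel \<theta>) $ k $ l")
    case True
    then show ?thesis using pos v by blast
  next
    case False
    then have 0: "snd (sel \<theta>) $ k $ l = 0"
      using nonneg_vecmatsD(2)[OF sel_nonneg, of k l] by simp
    obtain w where w: "w \<in> nonneg_vecmats" "snd (X w) $ k $ l \<noteq> 0"
      using assms(1) False by (auto simp: active_links_def)
    have "0 < snd (X w) $ k $ l"
      using link_tangent_nonneg[OF w(1) 0] w(2) by simp
    moreover have "0 \<le> snd (X v) $ k $ l"
      using link_tangent_nonneg[OF v 0] .
    moreover have "v + w \<in> nonneg_vecmats"
      using nonneg_vecmats_ray[OF v w(1), of 1] by simp
    ultimately have "A (X w) = snd w $ k $ l" "A (X (v + w)) = snd (v + w) $ k $ l"
      using w(1) pos[of w] pos[of "v + w"] by (simp_all add: linear_add[OF linear_X])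
    then show ?thesis
      by (simp add: linear_add[OF linear_X] linear_add[OF linA])
  qed
qed

section \<open>Invertibility of the derivative on active directions\<close>

definition active_space :: "'n vecmat set" where
  "active_space = {v. \<forall>k l. (k, l) \<notin> active_links \<longrightarrow> snd v $ k $ l = 0}"

lemma active_space_diag: "v \<in> active_space \<Longrightarrow> snd v $ k $ k = 0"
  by (auto simp: active_space_def active_links_def)

lemma subspace_active_space: "subspace active_space"
  by (auto simp: subspace_def active_space_def)

text \<open>Subsidy changes and profile changes share one type, so \<open>X\<close> can map
  \<open>active_space\<close> to itself. Off \<open>active_links\<close> the derivative vanishes
  along the whole cone, hence along differences of its elements.\<close>

lemma X_active_space:
  assumes "v \<in> active_space"
  shows "X v \<in> active_space"
proof -
  obtain x y where xy: "x \<in> nonneg_vecmats" "y \<in> nonneg_vecmats" "v = x - y"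
    using nonneg_vecmats_diff active_space_diag[OF assms] .
  have "snd (X w) $ k $ l = 0" if "w \<in> nonneg_vecmats" "(k, l) \<notin> active_links" for w k l
    using that self_link_tangent[OF that(1)] by (cases "k = l") (auto simp: active_links_def)
  with xy show ?thesis
    by (auto simp: active_space_def linear_diff[OF linear_X])
qed

text \<open>The derivatives of the marginal costs recover all action coordinates and all active link
  coordinates of \<open>v\<close> from \<open>X v\<close>; the others vanish by assumption.\<close>

lemma X_inj_active_space:
  assumes "v \<in> active_space" "X v = 0"
  shows "v = 0"
proof -
  note diag = active_space_diag[OF assms(1)]
  have "fst v $ k = 0" for k
  proof -
    obtain A where A: "(marginal_action_cost \<Gamma> k has_derivative A) (at (sel \<theta>) within nonneg_vecmats)"
      using marginal_action_cost_differentiable[OF valid sel_nonneg] by (auto simp: differentiable_def)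
    then have "A (X v) = fst v $ k"
      using action_tangent diag by blast
    then show ?thesis
      using assms(2) linear_0 has_derivative_linear[OF A] by metis
  qed
  moreover have "snd v $ k $ l = 0" for k l
  proof (cases "(k, l) \<in> active_links")
    case True
    then have "k \<noteq> l" by (simp add: active_links_def)
    then obtain A where A: "(marginal_link_cost \<Gamma> k l has_derivative A) (at (sel \<theta>) within nonneg_vecmats)"
      using marginal_link_cost_differentiable[OF valid sel_nonneg] by (auto simp: differentiable_def)
    then have "A (X v) = snd v $ k $ l"
      using link_tangent True diag by blast
    then show ?thesis
      using assms(2) linear_0 has_derivative_linear[OF A] by metis
  qed (use assms(1) in \<open>simp add: active_space_def\<close>)
  ultimately show ?thesis
    by (simp add: prod_eq_iff vec_eq_iff)
qed

text \<open>An injective linear map of a finite-dimensional space into itself is onto.\<close>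

lemma X_surj_active_space: "X ` active_space = active_space"
proof (rule subspace_dim_equal)
  show "subspace (X ` active_space)"
    by (rule linear_subspace_image[OF linear_X subspace_active_space])
  have "inj_on X active_space"
    using X_inj_active_space linear_X subspace_active_space
    by (simp add: linear_injective_on_subspace_0)
  then have "inj_on X (span active_space)"
    by (metis span_eq_iff subspace_active_space)
  then show "dim active_space \<le> dim (X ` active_space)"
    using dim_image_eq[OF linear_X] by simp
qed (use X_active_space subspace_active_space in auto)

text \<open>Chain rule for \<open>W\<close> and product rule for the bilinear payment. The resulting
  formula is linear in \<open>v\<close>, so it makes sense outside the cone too.\<close>

lemma lagrangian_ray_derivative:
  assumes "(W has_derivative W') (at (fst (sel \<theta>)) within {a. \<forall>k. 0 \<le> a $ k})" "v \<in> nonneg_vecmats"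
  shows "((\<lambda>t. lagrangian W sel \<mu> (\<theta> + t *\<^sub>R v)) has_real_derivative
      W' (fst (X v)) - \<mu> * (payment v (sel \<theta>) + payment \<theta> (X v))) (at 0 within {0..})"
proof -
  have "(W has_derivative W') (at (fst (sel \<theta>)) within fst ` nonneg_vecmats)"
    by (rule has_derivative_subset[OF assms(1)]) (auto simp: nonneg_vecmats_def)
  then have "((\<lambda>p. W (fst p)) has_derivative (\<lambda>p. W' (fst p))) (at (sel \<theta>) within nonneg_vecmats)"
    using diff_chain_within[of fst fst "sel \<theta>" nonneg_vecmats W W']
    by (auto simp: o_def intro: bounded_linear_imp_has_derivative bounded_linear_fst)
  from ray_chain[OF this assms(2)]
  have 1: "((\<lambda>t. W (fst (sel (\<theta> + t *\<^sub>R v)))) has_real_derivative W' (fst (X v))) (at 0 within {0..})" .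
  have "((\<lambda>t. \<theta> + t *\<^sub>R v) has_vector_derivative v) (at 0 within {0..})"
    by (auto intro!: derivative_eq_intros)
  from bounded_bilinear.has_vector_derivative[OF bounded_bilinear_payment this ray_derivative[OF assms(2)]]
  have "((\<lambda>t. payment (\<theta> + t *\<^sub>R v) (sel (\<theta> + t *\<^sub>R v))) has_real_derivative
      payment \<theta> (X v) + payment v (sel \<theta>)) (at 0 within {0..})"
    by (simp add: has_real_derivative_iff_has_vector_derivative)
  with 1 show ?thesis
    unfolding lagrangian_def by (auto intro!: derivative_eq_intros)
qed

end

section \<open>Replacing link subsidies by action subsidies\<close>

text \<open>As \<open>F'\<close> is convex with \<open>F'(0) = 0\<close>, the ratio
  \<open>F'(t) / t\<close> is nondecreasing. This gives \<open>y \<le> x\<close> and then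
  \<open>F'(y) \<le> (y / x) F'(x) \<le> y F''(x)\<close>, the last by super-quadraticity at
  \<open>x\<close>.\<close>

lemma super_quadratic_mean:
  assumes "super_quadratic f" "deriv_nn f 0 = 0" "0 \<le> y" "0 < x"
    and "0 < deriv_nn f x" "deriv_nn f y \<le> deriv_nn f x"
  shows "deriv_nn f x + deriv_nn f y \<le> deriv_nn (deriv_nn f) x * (x + y)"
proof -
  \<comment> \<open>Convexity between 0 and \<open>s\<close> with weight
    \<open>t / s\<close>.\<close>
  have chord: "deriv_nn f t * s \<le> t * deriv_nn f s" if "0 \<le> t" "t \<le> s" "0 < s" for t s
    using assms(1,2) that convex_onD[of "{0..}" "deriv_nn f" "t / s" 0 s]
    by (simp add: super_quadratic_def field_simps)
  have "y \<le> x"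
  proof (rule ccontr)
    assume "\<not> y \<le> x"
    then have "deriv_nn f x * y \<le> x * deriv_nn f y"
      using chord[of x y] assms(4) by simp
    also have "\<dots> \<le> x * deriv_nn f x"
      using assms(4,6) by simp
    also have "\<dots> < deriv_nn f x * y"
      using assms(5) \<open>\<not> y \<le> x\<close> by simp
    finally show False by simp
  qed
  then have "x * deriv_nn f y \<le> y * deriv_nn f x"
    using chord[of y x] assms(3,4) by (simp add: mult.commute)
  also have "\<dots> \<le> y * (x * deriv_nn (deriv_nn f) x)"
    using assms(1,3,4) by (intro mult_left_mono) (auto simp: super_quadratic_def)
  finally have "deriv_nn f y \<le> y * deriv_nn (deriv_nn f) x"
    using assms(4) by (simp add: mult.left_commute)
  moreover have "deriv_nn f x \<le> x * deriv_nn (deriv_nn f) x"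
    using assms(1,4) by (simp add: super_quadratic_def)
  ultimately show ?thesis
    by (simp add: algebra_simps)
qed

section \<open>Changes of a single coordinate and their payments\<close>

definition unit_link :: "('n::finite) \<Rightarrow> 'n \<Rightarrow> 'n vecmat" where
  "unit_link i j = (0, axis i (axis j 1))"

definition unit_action :: "('n::finite) \<Rightarrow> 'n vecmat" where
  "unit_action i = (axis i 1, 0)"

lemma unit_nth [simp]:
  "fst (unit_link i j) = 0" "snd (unit_link i j) $ k $ l = (if k = i \<and> l = j then 1 else 0)"
  "fst (unit_action i) $ k = (if k = i then 1 else 0)" "snd (unit_action i) = 0"
  by (auto simp: unit_link_def unit_action_def axis_def)

lemma unit_nonneg:
  "i \<noteq> j \<Longrightarrow> unit_link i j \<in> nonneg_vecmats" "unit_action i \<in> nonneg_vecmats"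
  by (auto simp: nonneg_vecmats_def unit_link_def unit_action_def axis_def)

lemma payment_unit_action: "payment (unit_action i) p = fst p $ i"
  by (simp add: payment_def transfer_def split_beta if_distrib[of "\<lambda>x. x * _"] cong: if_cong)

lemma payment_unit_link:
  assumes "i \<noteq> j"
  shows "payment (unit_link i j) p = link (snd p) i j"
proof -
  have "(\<Sum>l\<in>UNIV - {k}. snd (unit_link i j) $ k $ l * link (snd p) k l)
      = (if k = i then link (snd p) i j else 0)" for k
    using assms by (simp add: sum.remove[of _ j] if_distrib[of "\<lambda>x. x * _"] cong: if_cong)
  then show ?thesis
    by (simp add: payment_def transfer_def split_beta)
qed

text \<open>One intensity enters the link strength of both agents, so both link subsidies are paid
  on it.\<close>

lemma payment_at_unit_link:
  assumes "i \<noteq> j"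
  shows "payment s (unit_link i j) = snd s $ i $ j + snd s $ j $ i"
proof -
  have "(\<Sum>l\<in>UNIV - {k}. snd s $ k $ l * link (snd (unit_link i j)) k l)
      = (if k = i then snd s $ i $ j else 0) + (if k = j then snd s $ j $ i else 0)" for k
    using assms
    by (auto simp: link_def distrib_left sum.distrib if_distrib[of "\<lambda>x. _ * x"] sum.delta
        if_bool_eq_conj cong: if_cong)
  then show ?thesis
    by (simp add: payment_def transfer_def split_beta sum.distrib)
qed

context differentiable_selection
begin

text \<open>Lowering the larger of the two subsidies matters: it makes the marginal cost at
  \<open>g_ij\<close> at least that at \<open>g_ji\<close>, as \<open>super_quadratic_mean\<close>
  requires.\<close>

lemma larger_link_subsidy_zero:
  assumes W: "W differentiable_on {a. \<forall>k. 0 \<le> a $ k}"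
    and \<mu>: "0 < \<mu>"
    and action_foc: "\<And>k. foc_nn (\<lambda>t. lagrangian W sel \<mu> (vec_upd (fst \<theta>) k t, snd \<theta>)) (fst \<theta> $ k)"
    and link_foc: "foc_nn (\<lambda>t. lagrangian W sel \<mu> (fst \<theta>, mat_upd (snd \<theta>) i j t)) (snd \<theta> $ i $ j)"
    and ij: "i \<noteq> j"
    and s: "0 \<le> lsv \<Gamma> i j"
    and F: "super_quadratic (lcost \<Gamma> i j)"
    and u: "sub_linear (pay \<Gamma> i j)" "sub_linear (pay \<Gamma> j i)"
    and larger: "snd \<theta> $ j $ i \<le> snd \<theta> $ i $ j"
  shows "snd \<theta> $ i $ j = 0"
proof (rule ccontr)
  note gp = game_primitives[OF valid]
  note \<theta>_nn = nonneg_vecmatsD[OF subsidy]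
  note p_nn = nonneg_vecmatsD[OF sel_nonneg]
  assume "snd \<theta> $ i $ j \<noteq> 0"
  then have \<sigma>: "0 < snd \<theta> $ i $ j" "0 \<le> snd \<theta> $ j $ i"
    using \<theta>_nn(2) by (auto simp: order_less_le)
  let ?p = "sel \<theta>" and ?y = "unit_link i j"
  let ?a = "fst ?p" and ?g = "snd ?p"
  let ?F' = "deriv_nn (lcost \<Gamma> i j)"
  let ?F'' = "deriv_nn ?F'"
  define u1 where "u1 = pay \<Gamma> i j (?a $ i)"
  define u2 where "u2 = pay \<Gamma> j i (?a $ j)"
  define d1 where "d1 = deriv_nn (pay \<Gamma> i j) (?a $ i)"
  define d2 where "d2 = deriv_nn (pay \<Gamma> j i) (?a $ j)"
  have a: "0 < ?a $ k" for k
    using nash_action_foc(1)[OF valid nash_at subsidy] .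
  have pos: "0 < u1" "0 < u2" "0 \<le> d1" "0 \<le> d2" "0 < rho \<Gamma>"
    using gp(14)[of i j] gp(14)[of j i] gp(15)[of i j] gp(15)[of j i] ij a p_nn(1) gp(2)
    by (auto simp: u1_def u2_def d1_def d2_def)
  then have U: "0 < rho \<Gamma> * (u1 * u2)"
    by simp
  \<comment> \<open>At zero intensity the marginal cost vanishes, and the first-order inequality
    would bound \<open>\<sigma>_ij + s_ij + \<rho> u1 u2\<close> by 0.\<close>
  have g1: "0 < ?g $ i $ j"
  proof (rule ccontr)
    assume "\<not> 0 < ?g $ i $ j"
    then have "?g $ i $ j = 0"
      using p_nn(2)[of i j] by simp
    then show False
      using nash_link_foc(1)[OF valid nash_at ij] gp(9)[OF ij] \<sigma>(1) s U
      by (simp add: marginal_link_cost_def u1_def u2_def)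
  qed
  have F'_commute: "deriv_nn (lcost \<Gamma> j i) x = ?F' x" if "0 \<le> x" for x
    using gp(10)[OF ij] that by (auto intro!: deriv_nn_cong)
  \<comment> \<open>The same argument; this subsidy may be zero, so strictness comes from
    \<open>U\<close>.\<close>
  have g2: "0 < ?g $ j $ i"
  proof (rule ccontr)
    assume "\<not> 0 < ?g $ j $ i"
    then have "?g $ j $ i = 0"
      using p_nn(2)[of j i] by simp
    then show False
      using nash_link_foc(1)[OF valid nash_at ij[symmetric]] gp(9)[OF ij[symmetric]] gp(6)[OF ij] \<sigma>(2) s U
      by (simp add: marginal_link_cost_def u1_def u2_def mult.commute)
  qed
  have F1: "?F' (?g $ i $ j) = lsv \<Gamma> i j + rho \<Gamma> * (u1 * u2) + snd \<theta> $ i $ j"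
    using nash_link_foc(2)[OF valid nash_at ij g1]
    by (simp add: marginal_link_cost_def u1_def u2_def)
  have F2: "?F' (?g $ j $ i) = lsv \<Gamma> i j + rho \<Gamma> * (u1 * u2) + snd \<theta> $ j $ i"
    using nash_link_foc(2)[OF valid nash_at ij[symmetric] g2] F'_commute gp(6)[OF ij] g2
    by (simp add: marginal_link_cost_def u1_def u2_def mult.commute)
  have cost: "?F' (?g $ i $ j) + ?F' (?g $ j $ i) \<le> ?F'' (?g $ i $ j) * link ?g i j"
    unfolding link_def
    by (rule super_quadratic_mean[OF F gp(9)[OF ij]]) (use g1 g2 F1 F2 larger s U \<sigma> in auto)
  have benefit: "?a $ i * d1 \<le> u1" "?a $ j * d2 \<le> u2"
    using u p_nn(1) by (auto simp: sub_linear_def u1_def u2_def d1_def d2_def)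
  have y_active: "?y \<in> active_space"
    using ij g1 by (auto simp: active_space_def active_links_def)
  \<comment> \<open>\<open>v\<close> is the subsidy change whose first-order effect is to raise
    \<open>g_ij\<close> alone.\<close>
  then obtain v where v: "v \<in> active_space" "X v = ?y"
    using X_surj_active_space by (metis imageE)
  note v_diag = active_space_diag[OF v(1)]
  \<comment> \<open>The differentiated first-order conditions determine \<open>v\<close> from
    \<open>?y\<close>. Raising one link alters the marginal returns to action at its two ends
    only.\<close>
  have v_action: "fst v $ k = - rho \<Gamma> * ((if k = i then d1 * u2 else 0) + (if k = j then d2 * u1 else 0))" for k
  proof -
    obtain A where A: "(marginal_action_cost \<Gamma> k has_derivative A) (at ?p within nonneg_vecmats)"
      using marginal_action_cost_differentiable[OF valid sel_nonneg] by (auto simp: differentiable_def)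
    have "fst v $ k = A ?y"
      using action_tangent[OF A v_diag] v(2) by simp
    also have "\<dots> = - rho \<Gamma> * (\<Sum>l\<in>UNIV - {k}. link (snd ?y) k l *
         deriv_nn (pay \<Gamma> k l) (?a $ k) * pay \<Gamma> l k (?a $ l))"
      using marginal_action_cost_derivative_link[OF A sel_nonneg unit_nonneg(1)[OF ij]] by simp
    also have "(\<Sum>l\<in>UNIV - {k}. link (snd ?y) k l *
         deriv_nn (pay \<Gamma> k l) (?a $ k) * pay \<Gamma> l k (?a $ l)) =
         (\<Sum>l\<in>UNIV - {k}. (if l = j then (if k = i then d1 * u2 else 0) else 0)
            + (if l = i then (if k = j then d2 * u1 else 0) else 0))"
      using ij by (intro sum.cong) (auto simp: link_def u1_def u2_def d1_def d2_def)
    also have "\<dots> = (if k = i then d1 * u2 else 0) + (if k = j then d2 * u1 else 0)"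
      using ij by (simp add: sum.distrib)
    finally show ?thesis .
  qed
  \<comment> \<open>All other intensities are constant along \<open>?y\<close>, including
    \<open>g_ji\<close>, so no other link subsidy moves.\<close>
  have v_link: "snd v $ k $ l = (if k = i \<and> l = j then ?F'' (?g $ i $ j) else 0)" for k l
  proof (cases "(k, l) \<in> active_links")
    case True
    then have kl: "k \<noteq> l" by (simp add: active_links_def)
    obtain A where A: "(marginal_link_cost \<Gamma> k l has_derivative A) (at ?p within nonneg_vecmats)"
      using marginal_link_cost_differentiable[OF valid sel_nonneg kl] by (auto simp: differentiable_def)
    show ?thesis
      using link_tangent[OF True A v_diag] v(2)
        marginal_link_cost_derivative_link[OF A valid kl sel_nonneg unit_nonneg(1)[OF ij]]
      by (auto split: if_splits)
  next
    case False
    then show ?thesis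
      using v(1) ij g1 by (auto simp: active_space_def active_links_def)
  qed
  have v_eq: "v = (- (rho \<Gamma> * (d1 * u2))) *\<^sub>R unit_action i + (- (rho \<Gamma> * (d2 * u1))) *\<^sub>R unit_action j
      + ?F'' (?g $ i $ j) *\<^sub>R ?y"
    using ij by (auto simp: prod_eq_iff vec_eq_iff v_action v_link)
  obtain W' where W': "(W has_derivative W') (at ?a within {a. \<forall>k. 0 \<le> a $ k})"
    using W p_nn(1) unfolding differentiable_on_def differentiable_def by blast
  interpret payment: bounded_bilinear "payment :: 'n vecmat \<Rightarrow> 'n vecmat \<Rightarrow> real"
    by (rule bounded_bilinear_payment)
  have linW: "linear W'"
    using W' has_derivative_linear by blast
  \<comment> \<open>Neither \<open>v\<close> nor its negative need lie in the cone, so the linear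
    extension \<open>L\<close> of the derivative of the Lagrangian is used and evaluated coordinate
    by coordinate.\<close>
  define L where "L w = W' (fst (X w)) - \<mu> * (payment w ?p + payment \<theta> (X w))" for w
  have linL: "linear L"
    unfolding L_def
    by (rule linearI)
      (simp_all add: linear_add[OF linear_X] linear_scale[OF linear_X] linear_add[OF linW]
        linear_scale[OF linW] payment.add_left payment.add_right payment.scaleR_left
        payment.scaleR_right algebra_simps)
  note ray = lagrangian_ray_derivative[OF W', of _ \<mu>, folded L_def]
  \<comment> \<open>On coordinate directions \<open>L\<close> agrees with the derivatives in the
    planner's conditions: nonpositive for actions, and zero for the link since
    \<open>\<sigma>_ij > 0\<close>.\<close>
  have L_action: "L (unit_action k) \<le> 0" for k
  proof -
    have "\<theta> + t *\<^sub>R unit_action k = (vec_upd (fst \<theta>) k (fst \<theta> $ k + t), snd \<theta>)" for t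
      by (auto simp: prod_eq_iff vec_eq_iff)
    then have "((\<lambda>t. lagrangian W sel \<mu> (vec_upd (fst \<theta>) k (fst \<theta> $ k + t), snd \<theta>))
        has_vector_derivative L (unit_action k)) (at 0 within {0..})"
      using ray[OF unit_nonneg(2), of k] by (simp add: has_real_derivative_iff_has_vector_derivative)
    moreover obtain D where "((\<lambda>t. lagrangian W sel \<mu> (vec_upd (fst \<theta>) k (fst \<theta> $ k + t), snd \<theta>))
        has_real_derivative D) (at 0 within {0..})" "D \<le> 0"
      using foc_nn_shift[OF action_foc \<theta>_nn(1)] by blast
    ultimately show ?thesis
      using deriv_within_atLeast_unique
      by (fastforce simp: has_real_derivative_iff_has_vector_derivative)
  qed
  have L_link: "L ?y = 0"
  proof -
    have "\<theta> + t *\<^sub>R ?y = (fst \<theta>, mat_upd (snd \<theta>) i j (snd \<theta> $ i $ j + t))" for t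
      by (auto simp: prod_eq_iff vec_eq_iff mat_upd_def)
    then have "((\<lambda>t. lagrangian W sel \<mu> (fst \<theta>, mat_upd (snd \<theta>) i j (snd \<theta> $ i $ j + t)))
        has_vector_derivative L ?y) (at 0 within {0..})"
      using ray[OF unit_nonneg(1)[OF ij]] by (simp add: has_real_derivative_iff_has_vector_derivative)
    moreover obtain D where "((\<lambda>t. lagrangian W sel \<mu> (fst \<theta>, mat_upd (snd \<theta>) i j (snd \<theta> $ i $ j + t)))
        has_real_derivative D) (at 0 within {0..})" "0 < snd \<theta> $ i $ j \<Longrightarrow> D = 0"
      using foc_nn_shift[OF link_foc \<theta>_nn(2)] by blast
    ultimately show ?thesis
      using deriv_within_atLeast_unique \<sigma>(1)
      by (fastforce simp: has_real_derivative_iff_has_vector_derivative)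
  qed
  \<comment> \<open>Minus \<open>v\<close> is a feasible change of the subsidy: it lowers \<open>\<sigma>\<^sub>i\<^sub>j\<close> and raises \<open>\<beta>\<^sub>i\<close>, \<open>\<beta>\<^sub>j\<close>.\<close>
  have "L v = - (rho \<Gamma> * (d1 * u2)) * L (unit_action i) - (rho \<Gamma> * (d2 * u1)) * L (unit_action j)"
    by (subst v_eq) (simp add: linear_add[OF linL] linear_diff[OF linL] linear_neg[OF linL]
      linear_scale[OF linL] L_link)
  moreover have "rho \<Gamma> * (d1 * u2) * L (unit_action i) \<le> 0" "rho \<Gamma> * (d2 * u1) * L (unit_action j) \<le> 0"
    using pos L_action by (auto intro!: mult_nonneg_nonpos mult_nonneg_nonneg)
  ultimately have "0 \<le> L v"
    by simp
  have "payment v ?p = - (rho \<Gamma> * (d1 * u2) * ?a $ i) - rho \<Gamma> * (d2 * u1) * ?a $ j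
      + ?F'' (?g $ i $ j) * link ?g i j"
    by (subst v_eq) (simp add: payment.add_left payment.diff_left payment.minus_left
      payment.scaleR_left payment_unit_action payment_unit_link[OF ij])
  moreover have "rho \<Gamma> * (d1 * u2) * ?a $ i \<le> rho \<Gamma> * (u1 * u2)"
    using mult_left_mono[OF benefit(1), of "rho \<Gamma> * u2"] pos by (simp add: algebra_simps)
  moreover have "rho \<Gamma> * (d2 * u1) * ?a $ j \<le> rho \<Gamma> * (u1 * u2)"
    using mult_left_mono[OF benefit(2), of "rho \<Gamma> * u1"] pos by (simp add: algebra_simps)
  \<comment> \<open>By \<open>cost\<close>, \<open>F1\<close>, \<open>F2\<close> and the two bounds
    above, the sum is at least \<open>2 s_ij + 2 (\<sigma>_ij + \<sigma>_ji)\<close>.\<close>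
  ultimately have "0 < payment v ?p + payment \<theta> ?y"
    using cost F1 F2 \<sigma> s payment_at_unit_link[OF ij, of \<theta>] by linarith
  \<comment> \<open>\<open>?y\<close> changes no action, so the welfare term of \<open>L v\<close>
    vanishes.\<close>
  then have "L v < 0"
    using \<mu> linear_0[OF linW] by (simp add: L_def v(2))
  with \<open>0 \<le> L v\<close> show False by simp
qed

end

theorem theorem3:
  fixes \<Gamma> :: "('n::finite) network_game"
    and W :: "real ^ 'n \<Rightarrow> real"
    and B :: real
    and sel :: "'n vecmat \<Rightarrow> 'n vecmat"
    and \<beta> :: "real ^ 'n"
    and \<sigma> :: "real ^ 'n ^ 'n"
    and i j :: 'n
  assumes "valid_game \<Gamma>"
    and "planner_objective W"
    and "B > 0"
    and "equilibrium_selection \<Gamma> sel"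
    and "optimal_subsidy \<Gamma> W B sel (\<beta>, \<sigma>)"
    and "selection_differentiable_near \<Gamma> sel (\<beta>, \<sigma>)"
    and "budget_strictly_binds W B sel (\<beta>, \<sigma>)"
    and "i \<noteq> j"
    and "lsv \<Gamma> i j \<ge> 0"
    and "super_quadratic (lcost \<Gamma> i j)"
    and "sub_linear (pay \<Gamma> i j)"
    and "sub_linear (pay \<Gamma> j i)"
  shows "\<sigma> $ i $ j = 0 \<and> \<sigma> $ j $ i = 0"
proof -
  let ?\<theta> = "(\<beta>, \<sigma>)"
  have subsidy: "?\<theta> \<in> nonneg_vecmats"
    using assms(5) by (simp add: optimal_subsidy_def)
  obtain U where U: "open U" "?\<theta> \<in> U"
    "\<And>t. t \<in> U \<inter> nonneg_vecmats \<Longrightarrow> has_nash \<Gamma> t \<and> sel differentiable (at t within nonneg_vecmats)"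
    using assms(6) unfolding selection_differentiable_near_def by blast
  then obtain X where X: "(sel has_derivative X) (at ?\<theta> within nonneg_vecmats)"
    using subsidy unfolding differentiable_def by blast
  interpret differentiable_selection \<Gamma> sel ?\<theta> X
    using assms(1,4) subsidy U X by unfold_locales blast+
  obtain \<mu> where \<mu>: "0 < \<mu>"
    and action_foc: "\<And>k. foc_nn (\<lambda>t. lagrangian W sel \<mu> (vec_upd \<beta> k t, \<sigma>)) (\<beta> $ k)"
    and link_foc: "\<And>k l. k \<noteq> l \<Longrightarrow> foc_nn (\<lambda>t. lagrangian W sel \<mu> (\<beta>, mat_upd \<sigma> k l t)) (\<sigma> $ k $ l)"
    using assms(7) by (auto simp: budget_strictly_binds_def)
  have W: "W differentiable_on {a. \<forall>k. 0 \<le> a $ k}"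
    using assms(2) by (simp add: planner_objective_def)
  have zero: "\<sigma> $ k $ l = 0"
    if "k \<noteq> l" "0 \<le> lsv \<Gamma> k l" "super_quadratic (lcost \<Gamma> k l)"
      "sub_linear (pay \<Gamma> k l)" "sub_linear (pay \<Gamma> l k)" "\<sigma> $ l $ k \<le> \<sigma> $ k $ l" for k l
    using larger_link_subsidy_zero[OF W \<mu>, of k l] action_foc link_foc that by simp
  have "0 \<le> lsv \<Gamma> j i"
    using game_primitives(6)[OF assms(1,8)] assms(9) by simp
  moreover have "super_quadratic (lcost \<Gamma> j i)"
    using super_quadratic_cong[OF _ assms(10)] game_primitives(10)[OF assms(1,8)] by blast
  \<comment> \<open>Whichever subsidy is larger vanishes; the other lies between 0 and it.\<close>
  ultimately have "max (\<sigma> $ i $ j) (\<sigma> $ j $ i) = 0"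
    using zero[of i j] zero[of j i] assms(8-12) by (cases "\<sigma> $ j $ i \<le> \<sigma> $ i $ j") auto
  then show ?thesis
    using nonneg_vecmatsD(2)[OF subsidy, of i j] nonneg_vecmatsD(2)[OF subsidy, of j i]
    by (auto simp: max_def split: if_splits)
qed

end
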